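(* Let $s\in\mathbb{N}_0$. For $n\ge1$ and $1\le k\le n$, the generalized Stirling numbers $\mathfrak{S}_{s;h}(n,k|p,q)$ can be expressed as $$\mathfrak{S}_{s;h}(n,k|p,q)=h^{n-k}\sum_{\substack{\mathbf{k}\in\{0,1\}^{n-1}\\|\mathbf{k}|=n-k}}p^{\mathcal{P}_{n-1}(\mathbf{1},\mathbf{k})}\,q^{\mathcal{Q}_{n-1|s}(\mathbf{1},\mathbf{1},\mathbf{k})}\,\mathcal{A}_{n-1|s;p,q}(\mathbf{1},\mathbf{k}).$$
   Context: Let $X,Y,Z_p$ satisfy the relations of the $(p,q)$-deformed generalized Weyl algebra $A_{s;h|p,q}$: $XY-qYX=hY^sZ_p$, $Z_pY=pYZ_p$, $XZ_p=pZ_pX$, $Z_1=I$ ($s\in\mathbb{N}_0$, $h\in\mathbb{C}\setminus\{0\}$, $p,q\in\mathbb{C}$). The generalized Stirling numbers $\mathfrak{S}_{s;h}(n,k|p,q)$ are the normal ordering coefficients of $(YX)^n$: $$(YX)^n=\sum_{k=0}^n\mathfrak{S}_{s;h}(n,k|p,q)\,Y^{s(n-k)+k}Z_p^{n-k}X^k.$$ They satisfy the (known) recurrence $$\mathfrak{S}_{s;h}(n+1,k|p,q)=p^{n-k+1}q^{s(n-k+1)+k-1}\mathfrak{S}_{s;h}(n,k-1|p,q)+h[s(n-k)+k]_{p,q}\,\mathfrak{S}_{s;h}(n,k|p,q),$$ with $\mathfrak{S}_{s;h}(0,0|p,q)=1$ and $\mathfrak{S}_{s;h}(n,k|p,q)=0$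 unless $0\le k\le n$; this determines them. $[n]_{p,q}=\frac{p^n-q^n}{p-q}=\sum_{i=0}^{n-1}p^{n-1-i}q^i$. For $\mathbf{k}=(k_1,\dots,k_r)\in\{0,1\}^r$, $|\mathbf{k}|=\sum_jk_j$, and with $\mathbf{1}=(1,\dots,1)$ of length $r$, $$\mathcal{P}_r(\mathbf{1},\mathbf{k})=\sum_{j=1}^{r-1}(1-k_{j+1})\sum_{l=1}^jk_l,\qquad\mathcal{Q}_{r|s}(\mathbf{1},\mathbf{1},\mathbf{k})=\sum_{j=1}^r(1-k_j)\Big\{j+(s-1)\sum_{l=1}^{j-1}k_l\Big\},$$ $$\mathcal{A}_{r|s;p,q}(\mathbf{1},\mathbf{k})=\prod_{j=1}^r\prod_{\ell=0}^{k_j-1}\Big[j+(s-1)\sum_{l=1}^{j-1}k_l+(s-1)\ell\Big]_{p,q}.$$ Empty products are $1$ and empty sums are $0$. *)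

theory Defs
  imports Complex_Main "HOL-Library.FuncSet"
begin

text \<open>The sum form of \<open>[n]\<^sub>p\<^sub>,\<^sub>q\<close>, which also covers the case \<open>p = q\<close>.\<close>

definition pq_num :: "complex \<Rightarrow> complex \<Rightarrow> nat \<Rightarrow> complex" where
  "pq_num p q n = (\<Sum>i<n. p ^ (n - 1 - i) * q ^ i)"

lemma pq_num_0 [simp]: "pq_num p q 0 = 0"
  by (simp add: pq_num_def)

lemma pq_num_Suc: "pq_num p q (Suc n) = q ^ n + p * pq_num p q n"
proof -
  have "(\<Sum>i<n. p ^ (n - i) * q ^ i) = (\<Sum>i<n. p * (p ^ (n - 1 - i) * q ^ i))"
  proof (rule sum.cong)
    fix i assume "i \<in> {..<n}"
    then have "n - i = Suc (n - 1 - i)" by auto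
    then show "p ^ (n - i) * q ^ i = p * (p ^ (n - 1 - i) * q ^ i)" by simp
  qed simp
  then show ?thesis
    by (simp add: pq_num_def sum_distrib_left)
qed

lemma pq_num_quotient: "p \<noteq> q \<Longrightarrow> pq_num p q n = (p ^ n - q ^ n) / (p - q)"
proof (induction n)
  case (Suc n)
  have "(p - q) * pq_num p q (Suc n) = (p - q) * q ^ n + p * ((p - q) * pq_num p q n)"
    by (simp add: pq_num_Suc algebra_simps)
  also have "(p - q) * pq_num p q n = p ^ n - q ^ n"
    using Suc by simp
  finally have "(p - q) * pq_num p q (Suc n) = p ^ Suc n - q ^ Suc n"
    by (simp add: algebra_simps)
  then show ?case
    using Suc.prems by (simp add: nonzero_eq_divide_eq mult.commute)
qed simp

text \<open>
  The generalized Stirling numbers, defined by the recurrence that determines them. They are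
  not defined by comparing coefficients of \<open>(Y X)\<^sup>n\<close> in the algebra with generators
  \<open>X, Y, Z\<close>, since these are not unique in general: computing \<open>X Z Y\<close> in two ways from the relations
  gives \<open>h p (p\<^sup>s - 1) Y\<^sup>s Z\<^sup>2 = 0\<close>, so for \<open>p \<noteq> 0\<close> and \<open>p\<^sup>s \<noteq> 1\<close> the monomials
  \<open>Y\<^bsup>s(n-k)+k\<^esup> Z\<^bsup>n-k\<^esup> X\<^sup>k\<close> with \<open>n - k \<ge> 2\<close> vanish. That the numbers below
  are normal ordering coefficients is \<open>pq_gwa.normal_ordering\<close>.

  The \<open>k = 0\<close> equation omits the term with second index \<open>-1\<close>. In the last equation \<open>k\<close>
  stands for the mathematical \<open>k - 1\<close>; the truncated differences matter only for
  arguments beyond \<open>n\<close>, where the Stirling number next to them is \<open>0\<close>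
  (\<open>gen_stirling_eq_0\<close>).
\<close>

fun gen_stirling ::
  "nat \<Rightarrow> complex \<Rightarrow> complex \<Rightarrow> complex \<Rightarrow> nat \<Rightarrow> nat \<Rightarrow> complex" where
  "gen_stirling s h p q 0 0 = 1"
| "gen_stirling s h p q 0 (Suc k) = 0"
| "gen_stirling s h p q (Suc n) 0 = h * pq_num p q (s * n) * gen_stirling s h p q n 0"
| "gen_stirling s h p q (Suc n) (Suc k) =
     p ^ (n - k) * q ^ (s * (n - k) + k) * gen_stirling s h p q n k
     + h * pq_num p q (s * (n - Suc k) + Suc k) * gen_stirling s h p q n (Suc k)"

lemma gen_stirling_eq_0: "n < k \<Longrightarrow> gen_stirling s h p q n k = 0"
  by (induction s h p q n k rule: gen_stirling.induct) auto

locale pq_gwa = vector_space scale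
  for scale :: "complex \<Rightarrow> 'a::ring_1 \<Rightarrow> 'a" (infixr "*\<^sub>C" 75) +
  fixes s :: nat and h p q :: complex and X Y Z :: 'a
  assumes scale_mult_left: "(c *\<^sub>C x) * y = c *\<^sub>C (x * y)"
    and scale_mult_right: "x * (c *\<^sub>C y) = c *\<^sub>C (x * y)"
    and h_nonzero: "h \<noteq> 0"
    and XY: "X * Y - q *\<^sub>C (Y * X) = h *\<^sub>C (Y ^ s * Z)"
    and ZY: "Z * Y = p *\<^sub>C (Y * Z)"
    and XZ: "X * Z = p *\<^sub>C (Z * X)"
    and Z_eq_1: "p = 1 \<Longrightarrow> Z = 1"
begin

lemma YX_Y_power:
  "Y * X * Y ^ a = q ^ a *\<^sub>C (Y ^ Suc a * X) + (h * pq_num p q a) *\<^sub>C (Y ^ (s + a) * Z)"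
proof (induction a)
  case 0
  show ?case by simp
next
  case (Suc a)
  have XY': "X * Y = q *\<^sub>C (Y * X) + h *\<^sub>C (Y ^ s * Z)"
    using XY by (simp add: algebra_simps)
  have "Y * X * Y ^ Suc a = (Y * X * Y ^ a) * Y"
    by (simp only: power_Suc2 mult.assoc)
  also have "\<dots> = q ^ a *\<^sub>C (Y ^ Suc a * (X * Y))
      + (h * pq_num p q a) *\<^sub>C (Y ^ (s + a) * (Z * Y))"
    unfolding Suc.IH by (simp only: distrib_right scale_mult_left mult.assoc)
  also have "Y ^ Suc a * (X * Y) = q *\<^sub>C (Y ^ Suc (Suc a) * X) + h *\<^sub>C (Y ^ (s + Suc a) * Z)"
  proof -
    have "Y ^ Suc a * (Y * X) = Y ^ Suc (Suc a) * X"
      by (metis mult.assoc power_Suc2)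
    moreover have "Y ^ Suc a * (Y ^ s * Z) = Y ^ (s + Suc a) * Z"
      by (metis mult.assoc power_add add.commute)
    ultimately show ?thesis
      by (simp only: XY' distrib_left scale_mult_right)
  qed
  also have "Y ^ (s + a) * (Z * Y) = p *\<^sub>C (Y ^ (s + Suc a) * Z)"
    by (simp only: ZY scale_mult_right add_Suc_right power_Suc2 mult.assoc)
  finally have "Y * X * Y ^ Suc a = (q ^ a * q) *\<^sub>C (Y ^ Suc (Suc a) * X)
      + (q ^ a * h + h * pq_num p q a * p) *\<^sub>C (Y ^ (s + Suc a) * Z)"
    by (simp only: scale_right_distrib scale_left_distrib scale_scale add.assoc)
  moreover have "q ^ a * h + h * pq_num p q a * p = h * pq_num p q (Suc a)"
    by (simp add: pq_num_Suc algebra_simps)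
  ultimately show ?case
    by (simp only: power_Suc2)
qed

lemma X_Z_power: "X * Z ^ b = p ^ b *\<^sub>C (Z ^ b * X)"
proof (induction b)
  case (Suc b)
  have "X * Z ^ Suc b = (X * Z ^ b) * Z"
    by (simp only: power_Suc2 mult.assoc)
  also have "\<dots> = p ^ b *\<^sub>C (Z ^ b * (X * Z))"
    by (simp only: Suc.IH scale_mult_left mult.assoc)
  also have "\<dots> = p ^ Suc b *\<^sub>C (Z ^ Suc b * X)"
    by (simp add: XZ scale_mult_right power_Suc2 mult.assoc mult.commute del: power_Suc)
  finally show ?case .
qed simp

lemma YX_monomial:
  "(Y * X) * (Y ^ a * Z ^ b * X ^ k) =
     (p ^ b * q ^ a) *\<^sub>C (Y ^ Suc a * Z ^ b * X ^ Suc k)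
     + (h * pq_num p q a) *\<^sub>C (Y ^ (s + a) * Z ^ Suc b * X ^ k)"
proof -
  have "(Y * X) * (Y ^ a * Z ^ b * X ^ k) = (Y * X * Y ^ a) * Z ^ b * X ^ k"
    by (simp only: mult.assoc)
  also have "\<dots> = q ^ a *\<^sub>C (Y ^ Suc a * (X * Z ^ b) * X ^ k)
      + (h * pq_num p q a) *\<^sub>C (Y ^ (s + a) * (Z * Z ^ b) * X ^ k)"
    unfolding YX_Y_power by (simp only: distrib_right scale_mult_left mult.assoc)
  also have "\<dots> = (p ^ b * q ^ a) *\<^sub>C (Y ^ Suc a * Z ^ b * X ^ Suc k)
      + (h * pq_num p q a) *\<^sub>C (Y ^ (s + a) * Z ^ Suc b * X ^ k)"
    by (simp add: X_Z_power scale_mult_left scale_mult_right mult.assoc mult.commute)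
  finally show ?thesis .
qed

theorem normal_ordering:
  "(Y * X) ^ n =
     (\<Sum>k\<le>n. gen_stirling s h p q n k *\<^sub>C (Y ^ (s * (n - k) + k) * Z ^ (n - k) * X ^ k))"
proof (induction n)
  case 0
  show ?case by simp
next
  case (Suc n)
  define S where "S = gen_stirling s h p q"
  define M where "M = (\<lambda>n k. Y ^ (s * (n - k) + k) * Z ^ (n - k) * X ^ k)"
  define u where "u = (\<lambda>k. p ^ (n - k) * q ^ (s * (n - k) + k) * S n k)"
  define v where "v = (\<lambda>k. h * pq_num p q (s * (n - k) + k) * S n k)"
  have step: "(Y * X) * M n k = (p ^ (n - k) * q ^ (s * (n - k) + k)) *\<^sub>C M (Suc n) (Suc k)
      + (h * pq_num p q (s * (n - k) + k)) *\<^sub>C M (Suc n) k" if "k \<le> n" for k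
    using that unfolding M_def YX_monomial
    by (simp add: Suc_diff_le add.assoc)
  have "(Y * X) ^ Suc n = (Y * X) * (\<Sum>k\<le>n. S n k *\<^sub>C M n k)"
    unfolding S_def M_def by (simp only: power_Suc Suc.IH)
  also have "\<dots> = (\<Sum>k\<le>n. S n k *\<^sub>C ((Y * X) * M n k))"
    by (simp only: sum_distrib_left scale_mult_right)
  also have "\<dots> = (\<Sum>k\<le>n. u k *\<^sub>C M (Suc n) (Suc k) + v k *\<^sub>C M (Suc n) k)"
    by (intro sum.cong) (simp_all add: step u_def v_def scale_right_distrib mult.commute)
  also have "\<dots> = (\<Sum>k\<le>n. u k *\<^sub>C M (Suc n) (Suc k)) + (\<Sum>k\<le>n. v k *\<^sub>C M (Suc n) k)"
    by (rule sum.distrib)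
  also have "(\<Sum>k\<le>n. v k *\<^sub>C M (Suc n) k) = (\<Sum>k\<le>Suc n. v k *\<^sub>C M (Suc n) k)"
    by (simp add: v_def S_def gen_stirling_eq_0)
  also have "\<dots> = v 0 *\<^sub>C M (Suc n) 0 + (\<Sum>k\<le>n. v (Suc k) *\<^sub>C M (Suc n) (Suc k))"
    by (rule sum.atMost_Suc_shift)
  also have "(\<Sum>k\<le>n. u k *\<^sub>C M (Suc n) (Suc k)) + \<dots>
      = v 0 *\<^sub>C M (Suc n) 0 + (\<Sum>k\<le>n. (u k + v (Suc k)) *\<^sub>C M (Suc n) (Suc k))"
    by (simp add: scale_left_distrib sum.distrib algebra_simps)
  also have "\<dots> = S (Suc n) 0 *\<^sub>C M (Suc n) 0 + (\<Sum>k\<le>n. S (Suc n) (Suc k) *\<^sub>C M (Suc n) (Suc k))"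
    by (simp add: u_def v_def S_def)
  also have "\<dots> = (\<Sum>k\<le>Suc n. S (Suc n) k *\<^sub>C M (Suc n) k)"
    by (rule sum.atMost_Suc_shift[symmetric])
  finally show ?case
    unfolding S_def M_def .
qed

end

text \<open>
  A vector in \<open>{0,1}\<^sup>r\<close> is a function \<open>k \<in> {1..r} \<rightarrow>\<^sub>E {0,1}\<close>. The exponents and brackets are
  computed in the integers because of the factor \<open>s - 1\<close>, which is \<open>-1\<close> for \<open>s = 0\<close>.
  By \<open>bracket_arg_pos\<close>, the conversion to a natural number in \<open>A_coeff\<close> never truncates.
\<close>

definition P_exp :: "nat \<Rightarrow> (nat \<Rightarrow> nat) \<Rightarrow> int" where
  "P_exp r k = (\<Sum>j\<in>{1..<r}. (1 - int (k (j + 1))) * (\<Sum>l=1..j. int (k l)))"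

definition Q_exp :: "nat \<Rightarrow> nat \<Rightarrow> (nat \<Rightarrow> nat) \<Rightarrow> int" where
  "Q_exp r s k =
     (\<Sum>j=1..r. (1 - int (k j)) * (int j + (int s - 1) * (\<Sum>l\<in>{1..<j}. int (k l))))"

definition A_coeff :: "nat \<Rightarrow> nat \<Rightarrow> complex \<Rightarrow> complex \<Rightarrow> (nat \<Rightarrow> nat) \<Rightarrow> complex" where
  "A_coeff r s p q k =
     (\<Prod>j=1..r. \<Prod>l'<k j.
        pq_num p q (nat (int j + (int s - 1) * (\<Sum>l\<in>{1..<j}. int (k l)) + (int s - 1) * int l')))"

lemma bracket_arg_pos:
  assumes k: "k \<in> {1..r} \<rightarrow>\<^sub>E {0, 1}" and j: "j \<in> {1..r}" and l': "l' < k j"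
  shows "0 < int j + (int s - 1) * (\<Sum>l\<in>{1..<j}. int (k l)) + (int s - 1) * int l'"
proof -
  have le1: "k l \<le> 1" if "l \<in> {1..r}" for l
    using PiE_mem[OF k that] by auto
  have "l' = 0" using le1[OF j] l' by simp
  have "(\<Sum>l\<in>{1..<j}. int (k l)) \<le> (\<Sum>l\<in>{1..<j}. 1)"
  proof (rule sum_mono)
    fix l assume "l \<in> {1..<j}"
    then have "l \<in> {1..r}" using j by simp
    then show "int (k l) \<le> 1" using le1 by fastforce
  qed
  also have "\<dots> < int j" using j by simp
  finally have "(\<Sum>l\<in>{1..<j}. int (k l)) < int j" .
  moreover have "0 \<le> int s * (\<Sum>l\<in>{1..<j}. int (k l))"
    by (intro mult_nonneg_nonneg sum_nonneg) auto
  ultimately show ?thesis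
    using \<open>l' = 0\<close> by (simp add: left_diff_distrib)
qed

definition bin_vecs :: "nat \<Rightarrow> nat \<Rightarrow> (nat \<Rightarrow> nat) set" where
  "bin_vecs r m = {k \<in> {1..r} \<rightarrow>\<^sub>E {0, 1}. (\<Sum>j=1..r. k j) = m}"

end

theory Submission
  imports Defs
begin

text \<open>
  Removing the last entry of a vector \<open>v \<in> {0,1}\<^sup>n\<close> with \<open>\<bar>v\<bar> = m\<close> splits the sum over
  \<open>v\<close> into two parts. If the last entry is \<open>0\<close>, the weight gains the factor
  \<open>p\<^sup>m q\<^bsup>n+(s-1)m\<^esup>\<close>; if it is \<open>1\<close>, it gains \<open>[n + (s-1)(m-1)]\<^sub>p\<^sub>,\<^sub>q\<close>. With \<open>m = n + 1 - k\<close> these are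
  the coefficients in the recurrence of the Stirling numbers.
\<close>

section \<open>Binary vectors with prescribed sum, split by their last entry\<close>

lemma finite_bin_vecs: "finite (bin_vecs r m)"
  by (rule finite_subset[of _ "{1..r} \<rightarrow>\<^sub>E {0, 1}"]) (auto simp: bin_vecs_def intro!: finite_PiE)

lemma bin_vecs_le_1:
  assumes "v \<in> bin_vecs r m" and "l \<in> {1..r}"
  shows "v l \<le> 1"
  using assms PiE_mem[of v "{1..r}" "\<lambda>_. {0, 1}" l] by (auto simp: bin_vecs_def)

lemma bin_vecs_empty:
  assumes "r < m"
  shows "bin_vecs r m = {}"
proof -
  have False if v: "v \<in> bin_vecs r m" for v
  proof -
    have "(\<Sum>j=1..r. v j) \<le> (\<Sum>j=1..r. 1)"
      by (intro sum_mono bin_vecs_le_1[OF v])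
    with v assms show False by (simp add: bin_vecs_def)
  qed
  then show ?thesis by blast
qed

lemma bin_vecs_0_0: "bin_vecs 0 0 = {\<lambda>_. undefined}"
  by (auto simp: bin_vecs_def)

lemma sum_upd_last: "(\<Sum>j=1..Suc r. (v(Suc r := b)) j) = (\<Sum>j=1..r. v j) + (b :: nat)"
proof -
  have "(\<Sum>j=1..r. (v(Suc r := b)) j) = (\<Sum>j=1..r. v j)"
    by (rule sum.cong) auto
  then show ?thesis by simp
qed

text \<open>The second image is described by \<open>Suc (...) = m\<close> rather than by
  \<open>bin_vecs r (m - 1)\<close>: for \<open>m = 0\<close> it has to be empty, while the
  truncated difference would give the zero vector.\<close>

lemma bin_vecs_Suc:
  "bin_vecs (Suc r) m =
     (\<lambda>v. v(Suc r := 0)) ` bin_vecs r m \<union>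
     (\<lambda>v. v(Suc r := 1)) ` {v \<in> {1..r} \<rightarrow>\<^sub>E {0, 1}. Suc (\<Sum>j=1..r. v j) = m}"
proof -
  have "{1..Suc r} = insert (Suc r) {1..r}" by auto
  then have E: "{1..Suc r} \<rightarrow>\<^sub>E {0, 1 :: nat} =
      (\<lambda>v. v(Suc r := 0)) ` ({1..r} \<rightarrow>\<^sub>E {0, 1}) \<union>
      (\<lambda>v. v(Suc r := 1)) ` ({1..r} \<rightarrow>\<^sub>E {0, 1})"
    by (simp only: PiE_insert_eq) force
  have split: "{k \<in> f ` B \<union> g ` B. Q k} = f ` {v \<in> B. Q (f v)} \<union> g ` {v \<in> B. Q (g v)}"
    for f g :: "(nat \<Rightarrow> nat) \<Rightarrow> nat \<Rightarrow> nat" and B Q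
    by blast
  show ?thesis
    unfolding bin_vecs_def E split sum_upd_last by simp
qed

text \<open>No information is lost by overwriting: extensional functions on \<open>{1..r}\<close>
  all take the value \<open>undefined\<close> at \<open>Suc r\<close>.\<close>

lemma inj_on_upd_last: "inj_on (\<lambda>v. v(Suc r := b)) ({1..r} \<rightarrow>\<^sub>E T)"
proof (rule inj_onI)
  fix v w assume v: "v \<in> {1..r} \<rightarrow>\<^sub>E T" and w: "w \<in> {1..r} \<rightarrow>\<^sub>E T"
    and eq: "v(Suc r := b) = w(Suc r := b)"
  have "v (Suc r) = w (Suc r)"
    using PiE_arb[OF v, of "Suc r"] PiE_arb[OF w, of "Suc r"] by simp
  with eq show "v = w"
    by (metis fun_upd_triv fun_upd_upd)
qed

lemma bin_vecs_subset: "bin_vecs r m \<subseteq> {1..r} \<rightarrow>\<^sub>E {0, 1}"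
  by (auto simp: bin_vecs_def)

lemma sum_bin_vecs_Suc_0:
  "sum f (bin_vecs (Suc r) 0) = (\<Sum>v\<in>bin_vecs r 0. f (v(Suc r := 0)))"
  by (simp add: bin_vecs_Suc
      sum.reindex[OF inj_on_subset[OF inj_on_upd_last bin_vecs_subset]])

lemma sum_bin_vecs_Suc_Suc:
  "sum f (bin_vecs (Suc r) (Suc m)) =
     (\<Sum>v\<in>bin_vecs r (Suc m). f (v(Suc r := 0))) + (\<Sum>v\<in>bin_vecs r m. f (v(Suc r := 1)))"
proof -
  have E: "bin_vecs (Suc r) (Suc m) =
      (\<lambda>v. v(Suc r := 0)) ` bin_vecs r (Suc m) \<union> (\<lambda>v. v(Suc r := 1)) ` bin_vecs r m"
    by (simp add: bin_vecs_Suc) (simp add: bin_vecs_def)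
  have "(\<lambda>v. v(Suc r := 0)) ` bin_vecs r (Suc m) \<inter> (\<lambda>v. v(Suc r := 1)) ` bin_vecs r m = {}"
    by (auto dest: fun_cong[of _ _ "Suc r"])
  then show ?thesis
    unfolding E
    by (simp add: sum.union_disjoint finite_bin_vecs
        sum.reindex[OF inj_on_subset[OF inj_on_upd_last bin_vecs_subset]])
qed

section \<open>Effect of the last entry on the exponents and the bracket product\<close>

lemma sum_int_upd_last:
  "j \<le> r \<Longrightarrow> (\<Sum>l=1..j. int ((v(Suc r := b)) l)) = (\<Sum>l=1..j. int (v l))"
  "j \<le> Suc r \<Longrightarrow> (\<Sum>l\<in>{1..<j}. int ((v(Suc r := b)) l)) = (\<Sum>l\<in>{1..<j}. int (v l))"
  by (auto intro!: sum.cong)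

lemma bin_vecs_sum_int: "v \<in> bin_vecs r m \<Longrightarrow> (\<Sum>l=1..r. int (v l)) = int m"
  by (auto simp: bin_vecs_def simp flip: of_nat_sum)

text \<open>The new entry occurs only in the summand \<open>j = r\<close>, whose inner sum is the
  full sum \<open>m\<close> of \<open>v\<close>. For \<open>r = 0\<close> there is no such summand,
  but then \<open>m = 0\<close>.\<close>

lemma P_exp_upd_last:
  assumes "v \<in> bin_vecs r m"
  shows "P_exp (Suc r) (v(Suc r := b)) = P_exp r v + (1 - int b) * int m"
proof (cases "r = 0")
  case True
  with bin_vecs_sum_int[OF assms] show ?thesis by (simp add: P_exp_def)
next
  case False
  then have I: "{1..<Suc r} = insert r {1..<r}" by auto
  have "(\<Sum>j\<in>{1..<r}. (1 - int ((v(Suc r := b)) (j + 1))) * (\<Sum>l=1..j. int ((v(Suc r := b)) l)))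
      = P_exp r v"
    unfolding P_exp_def by (intro sum.cong arg_cong2[where f = "(*)"] sum_int_upd_last) auto
  moreover have "(\<Sum>l=1..r. int ((v(Suc r := b)) l)) = int m"
    using sum_int_upd_last(1)[of r r v b] bin_vecs_sum_int[OF assms] by simp
  ultimately show ?thesis
    \<comment> \<open>Keeping the update unevaluated at first lets the two sums above match; the
      second call evaluates it at \<open>Suc r\<close>.\<close>
    unfolding P_exp_def[of "Suc r"] I by (simp del: fun_upd_apply) simp
qed

lemma Q_exp_upd_last:
  assumes "v \<in> bin_vecs r m"
  shows "Q_exp (Suc r) s (v(Suc r := b)) =
    Q_exp r s v + (1 - int b) * (int (Suc r) + (int s - 1) * int m)"
proof -
  have "(\<Sum>j=1..r. (1 - int ((v(Suc r := b)) j)) *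
        (int j + (int s - 1) * (\<Sum>l\<in>{1..<j}. int ((v(Suc r := b)) l)))) = Q_exp r s v"
    unfolding Q_exp_def
    by (intro sum.cong arg_cong2[where f = "(*)"] arg_cong2[where f = "(+)"] sum_int_upd_last) auto
  moreover have "(\<Sum>l\<in>{1..<Suc r}. int ((v(Suc r := b)) l)) = int m"
    using sum_int_upd_last(2)[of "Suc r" r v b] bin_vecs_sum_int[OF assms]
    by (simp add: atLeastLessThanSuc_atLeastAtMost)
  ultimately show ?thesis
    unfolding Q_exp_def[of "Suc r"] by (simp del: fun_upd_apply) simp
qed

lemma A_coeff_upd_last:
  assumes "v \<in> bin_vecs r m"
  shows "A_coeff (Suc r) s p q (v(Suc r := b)) =
    A_coeff r s p q v *
    (\<Prod>l'<b. pq_num p q (nat (int (Suc r) + (int s - 1) * int m + (int s - 1) * int l')))"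
proof -
  have "(\<Prod>j=1..r. \<Prod>l'<(v(Suc r := b)) j. pq_num p q (nat (int j +
        (int s - 1) * (\<Sum>l\<in>{1..<j}. int ((v(Suc r := b)) l)) + (int s - 1) * int l')))
      = A_coeff r s p q v"
    unfolding A_coeff_def
  proof (rule prod.cong)
    fix j assume j: "j \<in> {1..r}"
    then have "(\<Sum>l\<in>{1..<j}. int ((v(Suc r := b)) l)) = (\<Sum>l\<in>{1..<j}. int (v l))"
      by (intro sum_int_upd_last) auto
    moreover have "(v(Suc r := b)) j = v j" using j by simp
    ultimately show "(\<Prod>l'<(v(Suc r := b)) j. pq_num p q (nat (int j +
        (int s - 1) * (\<Sum>l\<in>{1..<j}. int ((v(Suc r := b)) l)) + (int s - 1) * int l')))
      = (\<Prod>l'<v j. pq_num p q (nat (int j +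
        (int s - 1) * (\<Sum>l\<in>{1..<j}. int (v l)) + (int s - 1) * int l')))"
      by presburger
  qed simp
  moreover have "(\<Sum>l\<in>{1..<Suc r}. int ((v(Suc r := b)) l)) = int m"
    using sum_int_upd_last(2)[of "Suc r" r v b] bin_vecs_sum_int[OF assms]
    by (simp add: atLeastLessThanSuc_atLeastAtMost)
  ultimately show ?thesis
    unfolding A_coeff_def[of "Suc r"] by (simp del: fun_upd_apply) simp
qed

section \<open>Nonnegative exponents and the weight of a vector\<close>

lemma P_exp_nonneg:
  assumes "v \<in> bin_vecs r m"
  shows "0 \<le> P_exp r v"
  unfolding P_exp_def
proof (intro sum_nonneg mult_nonneg_nonneg)
  fix j assume "j \<in> {1..<r}"
  then show "0 \<le> 1 - int (v (j + 1))"
    using bin_vecs_le_1[OF assms, of "j + 1"] by simp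
qed simp

text \<open>At most \<open>j - 1\<close> entries before \<open>j\<close> equal \<open>1\<close>, so
  each second factor is positive even for \<open>s = 0\<close>, where \<open>s - 1\<close> is
  negative.\<close>

lemma Q_exp_nonneg:
  assumes v: "v \<in> bin_vecs r m"
  shows "0 \<le> Q_exp r s v"
  unfolding Q_exp_def
proof (intro sum_nonneg mult_nonneg_nonneg)
  fix j assume j: "j \<in> {1..r}"
  then show "0 \<le> 1 - int (v j)"
    using bin_vecs_le_1[OF v, of j] by simp
  have "(\<Sum>l\<in>{1..<j}. int (v l)) \<le> (\<Sum>l\<in>{1..<j}. 1)"
  proof (rule sum_mono)
    fix l assume "l \<in> {1..<j}"
    with j show "int (v l) \<le> 1" using bin_vecs_le_1[OF v, of l] by simp
  qed
  moreover have "0 \<le> int s * (\<Sum>l\<in>{1..<j}. int (v l))"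
    by (intro mult_nonneg_nonneg sum_nonneg) auto
  ultimately show "0 \<le> int j + (int s - 1) * (\<Sum>l\<in>{1..<j}. int (v l))"
    using j by (simp add: left_diff_distrib)
qed

text \<open>For nonnegative exponents the addition law also holds at base \<open>0\<close>.\<close>

lemma power_int_add_nat:
  "0 \<le> a \<Longrightarrow> (x :: complex) powi (a + int n) = x powi a * x ^ n"
  by (simp add: power_int_def nat_add_distrib power_add)

definition vec_weight :: "nat \<Rightarrow> nat \<Rightarrow> complex \<Rightarrow> complex \<Rightarrow> (nat \<Rightarrow> nat) \<Rightarrow> complex" where
  "vec_weight r s p q v = p powi P_exp r v * q powi Q_exp r s v * A_coeff r s p q v"

lemma vec_weight_upd_0:
  assumes v: "v \<in> bin_vecs r m" and "m \<le> Suc r"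
  shows "vec_weight (Suc r) s p q (v(Suc r := 0)) =
    p ^ m * q ^ (s * m + (Suc r - m)) * vec_weight r s p q v"
proof -
  have "int (Suc r) + (int s - 1) * int m = int (s * m + (Suc r - m))"
    using \<open>m \<le> Suc r\<close> by (simp add: left_diff_distrib)
  then show ?thesis
    unfolding vec_weight_def P_exp_upd_last[OF v] Q_exp_upd_last[OF v] A_coeff_upd_last[OF v]
    by (simp add: power_int_add_nat P_exp_nonneg[OF v] Q_exp_nonneg[OF v] del: of_nat_Suc of_nat_add)
qed

text \<open>Here \<open>m\<close> counts the ones before the appended \<open>1\<close>, so the new
  vector has \<open>m + 1\<close> ones. The exponents do not change because their increments carry
  the factor \<open>1 - b\<close>.\<close>

lemma vec_weight_upd_1:
  assumes v: "v \<in> bin_vecs r m" and "m \<le> Suc r"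
  shows "vec_weight (Suc r) s p q (v(Suc r := 1)) =
    pq_num p q (s * m + (Suc r - m)) * vec_weight r s p q v"
proof -
  have "int (Suc r) + (int s - 1) * int m = int (s * m + (Suc r - m))"
    using \<open>m \<le> Suc r\<close> by (simp add: left_diff_distrib)
  then show ?thesis
    unfolding vec_weight_def P_exp_upd_last[OF v] Q_exp_upd_last[OF v] A_coeff_upd_last[OF v]
    \<comment> \<open>\<open>of_nat_Suc\<close> is disabled so that the bracket argument matches the
      identity above; \<open>int (Suc 0)\<close> then needs its own rule.\<close>
    by (simp add: lessThan_Suc of_nat_1[unfolded One_nat_def] del: of_nat_Suc of_nat_add)
qed

section \<open>Induction along the Stirling recurrence\<close>

lemma gen_stirling_Suc_0: "gen_stirling s h p q (Suc n) 0 = 0"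
  by (induction n) auto

text \<open>The case \<open>k = 0\<close>, where both sides vanish, is included because the
  recurrence for \<open>k = 1\<close> refers back to it.\<close>

lemma gen_stirling_eq_sum_vec_weight:
  "k \<le> Suc r \<Longrightarrow> gen_stirling s h p q (Suc r) k =
     h ^ (Suc r - k) * sum (vec_weight r s p q) (bin_vecs r (Suc r - k))"
proof (induction r arbitrary: k)
  case 0
  then consider "k = 0" | "k = 1" by linarith
  then show ?case
    by cases
      (auto simp: bin_vecs_empty bin_vecs_0_0 vec_weight_def P_exp_def Q_exp_def A_coeff_def)
next
  case (Suc r)
  show ?case
  proof (cases k)
    case 0
    then show ?thesis
      by (simp add: gen_stirling_Suc_0 bin_vecs_empty del: gen_stirling.simps)
  next
    case (Suc k')
    \<comment> \<open>The number of ones in the vectors of length \<open>Suc r\<close>; a final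
      \<open>0\<close> leaves all \<open>m\<close> of them among the first \<open>r\<close>
      entries.\<close>
    define m where "m = Suc r - k'"
    have k': "k' = Suc r - m" and m: "m \<le> Suc r"
      using Suc.prems Suc by (auto simp: m_def)
    have zero: "(\<Sum>v\<in>bin_vecs r m. vec_weight (Suc r) s p q (v(Suc r := 0))) =
        p ^ m * q ^ (s * m + k') * sum (vec_weight r s p q) (bin_vecs r m)"
      unfolding sum_distrib_left k' by (intro sum.cong vec_weight_upd_0 m refl)
    have IH: "gen_stirling s h p q (Suc r) k' =
        h ^ m * sum (vec_weight r s p q) (bin_vecs r m)"
      unfolding m_def using Suc.prems Suc by (intro Suc.IH) simp
    show ?thesis
    proof (cases m)
      case 0
      \<comment> \<open>Now \<open>Suc k'\<close> exceeds \<open>Suc r\<close>, so the bracket term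
        of the recurrence vanishes, just as no vector without ones ends in \<open>1\<close>.\<close>
      then have "k' = Suc r" using k' by simp
      then show ?thesis
        using IH zero Suc 0
        by (simp add: gen_stirling_eq_0 sum_bin_vecs_Suc_0 del: gen_stirling.simps(1-3))
    next
      case (Suc m')
      have k'': "Suc k' = Suc r - m'" and m': "m' \<le> Suc r"
        using Suc k' m by auto
      \<comment> \<open>A final \<open>1\<close> leaves \<open>m'\<close> ones, and the resulting
        bracket is the one in the recurrence.\<close>
      have one: "(\<Sum>v\<in>bin_vecs r m'. vec_weight (Suc r) s p q (v(Suc r := 1))) =
          pq_num p q (s * m' + Suc k') * sum (vec_weight r s p q) (bin_vecs r m')"
        unfolding sum_distrib_left k'' by (intro sum.cong vec_weight_upd_1 m' refl)
      have IH': "gen_stirling s h p q (Suc r) (Suc k') =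
          h ^ m' * sum (vec_weight r s p q) (bin_vecs r m')"
        using Suc.IH[of "Suc k'"] m' by (simp add: k'' del: gen_stirling.simps)
      have diff: "Suc r - Suc k' = m'"
        using k'' m' by simp
      have "gen_stirling s h p q (Suc (Suc r)) (Suc k') =
          p ^ m * q ^ (s * m + k') * gen_stirling s h p q (Suc r) k'
          + h * pq_num p q (s * m' + Suc k') * gen_stirling s h p q (Suc r) (Suc k')"
        unfolding gen_stirling.simps(4)[of s h p q "Suc r"] diff m_def by (rule refl)
      \<comment> \<open>The factor \<open>h\<close> of the bracket term raises \<open>h ^ m'\<close>
        to \<open>h ^ m\<close>, so both terms share this power.\<close>
      also have "\<dots> = h ^ m * sum (vec_weight (Suc r) s p q) (bin_vecs (Suc r) m)"
        unfolding IH IH' using zero one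
        by (simp add: Suc sum_bin_vecs_Suc_Suc algebra_simps)
      finally show ?thesis
        using \<open>k = Suc k'\<close> by (simp add: m_def del: gen_stirling.simps)
    qed
  qed
qed

theorem proposition3p7:
  fixes s n k :: nat and h p q :: complex
  assumes "h \<noteq> 0" and "1 \<le> n" and "1 \<le> k" and "k \<le> n"
  shows "gen_stirling s h p q n k =
    h ^ (n - k) *
    (\<Sum>v \<in> bin_vecs (n - 1) (n - k).
       p powi P_exp (n - 1) v * q powi Q_exp (n - 1) s v * A_coeff (n - 1) s p q v)"
  using gen_stirling_eq_sum_vec_weight[of k "n - 1" s h p q] assms
  by (simp add: vec_weight_def)

end
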